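(* Let $A\in\mathbb{R}^{n\times n}$ be symmetric positive semidefinite with eigenvalues $\{\lambda_i\}_{i=1}^n$, and let $f:[0,\infty)\to\mathbb{R}$ be convex and twice continuously differentiable. For each of $q$ independent trials, generate an $n\times b$ random matrix $V$ with orthonormal columns, satisfying $\mathbb{E}[VV^T]=\frac{b}{n}I_n$, and define $$X(V):=\frac{n}{b}\,\operatorname{tr}\bigl(V^T f(A)V\bigr).$$ Let $V_1,\dots,V_q$ denote the matrices generated in the $q$ independent trials. Then the Monte Carlo estimator $$\widehat T:=\frac1q\sum_{i=1}^q X(V_i)$$ satisfies: 1. $\mathbb{E}[X(V)]=\operatorname{tr}\bigl(f(A)\bigr)$. (If $b=n$, then $VV^T=I_n$ and $X(V)$ is exact, i.e. $X(V)=\operatorname{tr}(f(A))$.) 2. The variance is $$\operatorname{Var}[X(V)]=\frac{2n}{b(n+2)}\left(1-\frac{b-1}{n-1}\right)\left(\sum_{i=1}^n f(\lambda_i)^2-\frac1n\bigl(\operatorname{tr}(f(A))\bigr)^2\right),$$ and $$\operatorname{Var}[\widehat T]=\frac1q\operatorname{Var}[X(V)].$$ 3. If $X(V)\in[\ell_{\min},\ell_{\max}]$ almost surely, then for any $\varepsilon>0$, $$\mathbb{P}\left(\bigl|\widehat T-\operatorname{tr}(f(A))\bigr|\ge\varepsilon\right)\le 2\exp\left(-\frac{2q\varepsilon^2}{(\ell_{\max}-\ell_{\min})^2}\right),$$ so that with probability at least $1-\delta$, $$\bigl|\widehat T-\operatorname{tr}(f(A))\bigr|\le(\ell_{\max}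-\ell_{\min})\sqrt{\frac{\ln(2/\delta)}{2q}}.$$
   Context: Here $n$, $b$ (the block size, $b\le n$) and $q$ (the number of trials) are positive integers, $I_n$ is the $n\times n$ identity matrix, and $\operatorname{tr}$ denotes the trace. For a symmetric positive semidefinite matrix $A=Q\,\mathrm{diag}(\lambda_1,\dots,\lambda_n)\,Q^T$ with $Q$ orthogonal, $f(A):=Q\,\mathrm{diag}(f(\lambda_1),\dots,f(\lambda_n))\,Q^T$. The eigenvalues are listed with multiplicity. A matrix $V\in\mathbb{R}^{n\times b}$ has orthonormal columns if $V^TV=I_b$. The symbols $\mathbb{E}$, $\operatorname{Var}$ and $\mathbb{P}$ denote expectation, variance and probability over the random draw of $V$ (or of $V_1,\dots,V_q$); $\ell_{\min},\ell_{\max}$ are real constants and $\delta\in(0,1)$.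
   Formalization: The closed formula for Var[X(V)] is proved only for V uniformly (Haar) distributed on the n×b matrices with orthonormal columns; it fails under E[VV^T]=(b/n)I alone (n=2, b=1, A=diag(1,0), f(x)=x, V uniform on {e1,e2}). *)

theory Defs
  imports "HOL-Probability.Probability"
begin

definition sym_psd :: "real^'n^'n \<Rightarrow> bool" where
  "sym_psd A \<longleftrightarrow> transpose A = A \<and> (\<forall>x. 0 \<le> x \<bullet> (A *v x))"

text \<open>Listing with (algebraic) multiplicity: the characteristic polynomial splits accordingly.\<close>

definition eigenvalue_list :: "real^'n^'n \<Rightarrow> ('n \<Rightarrow> real) \<Rightarrow> bool" where
  "eigenvalue_list A l \<longleftrightarrow> (\<forall>t. det (mat t - A) = (\<Prod>i\<in>UNIV. t - l i))"

definition diag_mat :: "('n \<Rightarrow> real) \<Rightarrow> real^'n^'n" where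
  "diag_mat d = (\<chi> i j. if i = j then d i else 0)"

text \<open>The value does not depend on the chosen orthogonal diagonalisation, hence the
  definite description; it is meaningful for symmetric \<open>A\<close> only.\<close>

definition mat_fun :: "(real \<Rightarrow> real) \<Rightarrow> real^'n^'n \<Rightarrow> real^'n^'n" where
  "mat_fun f A = (THE B. \<exists>Q d. orthogonal_matrix Q
      \<and> A = Q ** diag_mat d ** transpose Q
      \<and> B = Q ** diag_mat (\<lambda>i. f (d i)) ** transpose Q)"

text \<open>Twice continuously differentiable on \<open>[0,\<infinity>)\<close>, with one-sided derivatives at \<open>0\<close>;
  the values of \<open>f\<close> at negative arguments are irrelevant.\<close>

definition C2_nonneg :: "(real \<Rightarrow> real) \<Rightarrow> bool" where
  "C2_nonneg f \<longleftrightarrow> (\<exists>f' f''.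
      (\<forall>x\<ge>0. (f has_real_derivative f' x) (at x within {0..})) \<and>
      (\<forall>x\<ge>0. (f' has_real_derivative f'' x) (at x within {0..})) \<and>
      continuous_on {0..} f'')"

text \<open>An \<open>n \<times> b\<close> matrix has type \<open>real^'b^'n\<close>.\<close>

definition orthonormal_columns :: "real^'b^'n \<Rightarrow> bool" where
  "orthonormal_columns V \<longleftrightarrow> transpose V ** V = mat 1"

text \<open>The uniform (Haar) distribution on the Stiefel manifold of \<open>n \<times> b\<close> matrices with
  orthonormal columns: the unique Borel probability measure on it that is invariant under
  left multiplication by orthogonal matrices.\<close>

definition haar_stiefel :: "(real^'b^'n) measure \<Rightarrow> bool" where
  "haar_stiefel D \<longleftrightarrow> prob_space D \<and> sets D = sets borel
      \<and> (AE W in D. orthonormal_columns W)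
      \<and> (\<forall>Q::real^'n^'n. orthogonal_matrix Q \<longrightarrow> distr D borel (\<lambda>W. Q ** W) = D)"

definition mc_sample :: "(real \<Rightarrow> real) \<Rightarrow> real^'n^'n \<Rightarrow> real^'b^'n \<Rightarrow> real" where
  "mc_sample f A V =
     real CARD('n) / real CARD('b) * trace (transpose V ** mat_fun f A ** V)"

definition mc_estimator ::
    "nat \<Rightarrow> (real \<Rightarrow> real) \<Rightarrow> real^'n^'n \<Rightarrow> (nat \<Rightarrow> real^'b^'n) \<Rightarrow> real" where
  "mc_estimator q f A W = 1 / real q * (\<Sum>i=1..q. mc_sample f A (W i))"

end

theory Submission imports Defs begin

text \<open>
  Everything is expressed through the random orthogonal projection \<open>P = V V\<^sup>T\<close> of rank \<open>b\<close>:
  the sample is the linear functional \<open>X(V) = (n/b) tr (f(A) P)\<close> of it, so the mean of \<open>X\<close> follows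
  from the mean of \<open>P\<close>. A projection has entries in \<open>[-1, 1]\<close>, so that every polynomial in them is
  integrable. If \<open>b = n\<close> then \<open>P\<close> has diagonal entries at most 1 and trace \<open>n\<close>, which forces
  \<open>P = I\<close>.

  For the variance formula, diagonalise \<open>A = Q D Q\<^sup>T\<close>. The Haar law does not see the rotation
  \<open>V \<mapsto> Q\<^sup>T V\<close>, so \<open>X\<close> is distributed like \<open>(n/b) \<Sum>\<^sub>i f(\<lambda>\<^sub>i) P\<^sub>i\<^sub>i\<close>, and the second moments
  of the diagonal of \<open>P\<close> decide everything. Let \<open>a = E P\<^sub>i\<^sub>i\<^sup>2\<close>, \<open>c = E P\<^sub>i\<^sub>i P\<^sub>j\<^sub>j\<close> and
  \<open>e = E P\<^sub>i\<^sub>j\<^sup>2\<close> for \<open>i \<noteq> j\<close>; by permuting coordinates they do not depend on the indices. Three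
  linear relations determine them: \<open>tr P = b\<close> gives \<open>a + (n-1) c = b\<^sup>2/n\<close>
  (\<open>sum_diag_products\<close>), \<open>P\<^sup>2 = P\<close> gives \<open>a + (n-1) e = b/n\<close> (\<open>sum_row_squares\<close>), and the fact that
  \<open>E (x \<bullet> P x)\<^sup>2\<close> is the same for all unit vectors \<open>x\<close>, applied to
  \<open>(e\<^sub>i \<plusminus> e\<^sub>j)/\<surd>2\<close>, gives \<open>a = c + 2 e\<close> (\<open>expectation_off_diag\<close>). Hence
  \<open>a = b(b+2)/(n(n+2))\<close>, and the variance of \<open>\<Sum>\<^sub>i g\<^sub>i P\<^sub>i\<^sub>i\<close> follows (\<open>variance_diag_form\<close>).
  No integration over the Stiefel manifold is involved.

  What remains is linear algebra and standard probability. The spectral theorem makes \<open>f(A)\<close>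
  meaningful (\<open>symmetric_matrix_diagonalizable\<close>, \<open>mat_fun_eqI\<close>); comparing roots of the characteristic
  polynomial identifies the prescribed eigenvalue list with the diagonal of \<open>D\<close>
  (\<open>eigenvalue_list_mset_unique\<close>). The estimator is a mean of independent copies of \<open>X\<close>, so its
  variance is additive, and the tail bound is Hoeffding's inequality, which is then solved for the
  deviation at level \<open>\<delta>\<close>.
\<close>

section \<open>Spectral theorem and functional calculus\<close>

lemma symmetric_matrix_dot:
  fixes A :: "real^'n^'n"
  assumes "transpose A = A"
  shows "x \<bullet> (A *v y) = (A *v x) \<bullet> y"
proof -
  have "A *v x = x v* A"
    using transpose_matrix_vector[of A x] assms by simp
  then show ?thesis by (simp add: dot_lmul_matrix)
qed

text \<open>
  The maximiser \<open>x\<close> of the Rayleigh quotient on the unit sphere of \<open>S\<close> is an eigenvector: with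
  \<open>r = A x - c x\<close>, the nonnegative quadratic form \<open>c (y \<bullet> y) - y \<bullet> A y\<close> vanishes at \<open>x\<close> and has slope
  \<open>-2 (r \<bullet> r)\<close> there in the direction \<open>r \<in> S\<close>, hence \<open>r = 0\<close>.
\<close>

lemma symmetric_eigenvector_exists:
  fixes A :: "real^'n^'n"
  assumes sym: "transpose A = A" and S: "subspace S" and inv: "\<And>x. x \<in> S \<Longrightarrow> A *v x \<in> S"
    and z: "z \<in> S" "z \<noteq> 0"
  obtains x c where "x \<in> S" "norm x = 1" "A *v x = c *\<^sub>R x"
proof -
  have lin: "A *v (x + t *\<^sub>R y) = A *v x + t *\<^sub>R (A *v y)" for x y t
    by (simp add: matrix_vector_right_distrib matrix_vector_mult_scaleR)
  let ?K = "S \<inter> sphere 0 1"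
  have "compact ?K"
    by (metis S closed_subspace compact_sphere closed_Int_compact)
  moreover have "(1 / norm z) *\<^sub>R z \<in> ?K"
    using z S by (simp add: subspace_scale)
  moreover have "continuous_on ?K (\<lambda>x. x \<bullet> (A *v x))"
    by (intro continuous_intros linear_continuous_on matrix_vector_mul_bounded_linear)
  ultimately obtain x where x: "x \<in> ?K"
    and max: "\<And>y. y \<in> ?K \<Longrightarrow> y \<bullet> (A *v y) \<le> x \<bullet> (A *v x)"
    using continuous_attains_sup[of ?K "\<lambda>x. x \<bullet> (A *v x)"] by blast
  define c where "c = x \<bullet> (A *v x)"
  define r where "r = A *v x - c *\<^sub>R x"
  have xx: "x \<bullet> x = 1" using x by (simp add: norm_eq_1)
  have r: "r \<in> S"
    using x S inv by (simp add: r_def subspace_diff subspace_scale)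
  have le: "y \<bullet> (A *v y) \<le> c * (y \<bullet> y)" if "y \<in> S" for y
  proof (cases "y = 0")
    case False
    have "(1 / norm y) *\<^sub>R y \<in> ?K" using that S False by (simp add: subspace_scale)
    from max[OF this] have "(y \<bullet> (A *v y)) / (norm y)\<^sup>2 \<le> c"
      by (simp add: c_def matrix_vector_mult_scaleR power2_eq_square)
    then show ?thesis using False
      by (simp add: pos_divide_le_eq power2_norm_eq_inner)
  qed simp
  have xr: "x \<bullet> r = 0" by (simp add: r_def inner_diff_right c_def xx)
  have "A *v x = r + c *\<^sub>R x" by (simp add: r_def)
  then have rAx: "r \<bullet> (A *v x) = r \<bullet> r"
    using xr by (simp add: inner_add_right inner_commute)
  then have xAr: "x \<bullet> (A *v r) = r \<bullet> r"
    by (simp add: symmetric_matrix_dot[OF sym, of x r] inner_commute)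
  have quad: "2 * t * (r \<bullet> r) \<le> t\<^sup>2 * (c * (r \<bullet> r) - r \<bullet> (A *v r))" for t
  proof -
    have "x + t *\<^sub>R r \<in> S" using x r S by (simp add: subspace_add subspace_scale)
    from le[OF this] show ?thesis
      using rAx xAr xr xx
      by (simp add: lin inner_add_left inner_add_right c_def[symmetric] inner_commute[of r x]
          algebra_simps power2_eq_square)
  qed
  define g where "g = c * (r \<bullet> r) - r \<bullet> (A *v r)"
  have "r \<bullet> r = 0"
  proof (rule ccontr)
    assume "r \<bullet> r \<noteq> 0"
    then have pos: "r \<bullet> r > 0" by simp
    have g: "g \<ge> 0" using le[OF r] by (simp add: g_def)
    \<comment> \<open>The shift by 1 keeps the denominator positive when \<open>g = 0\<close>.\<close>
    define t where "t = (r \<bullet> r) / (g + 1)"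
    have t: "t > 0" "t * (g + 1) = r \<bullet> r" using pos g by (auto simp: t_def)
    have "2 * t * (r \<bullet> r) \<le> t * (t * g)"
      using quad[of t] by (simp add: g_def power2_eq_square mult.assoc)
    then have "2 * (r \<bullet> r) \<le> t * g" using t(1) by simp
    moreover have "t * g \<le> r \<bullet> r" using t by (simp add: distrib_left)
    ultimately show False using pos by simp
  qed
  then have "A *v x = c *\<^sub>R x" by (simp add: r_def)
  with x show thesis by (intro that[of x c]) auto
qed

text \<open>
  An orthonormal set of eigenvectors of maximal size spans: its orthogonal complement is invariant
  under \<open>A\<close> and, if nonzero, would contribute one more eigenvector.
\<close>

lemma symmetric_orthonormal_eigenbasis:
  fixes A :: "real^'n^'n"
  assumes sym: "transpose A = A"
  obtains B where "pairwise orthogonal B" "\<And>x. x \<in> B \<Longrightarrow> norm x = 1"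
    "\<And>x. x \<in> B \<Longrightarrow> \<exists>c. A *v x = c *\<^sub>R x" "card B = CARD('n)"
proof -
  define P where "P B \<longleftrightarrow> pairwise orthogonal B \<and>
      (\<forall>x\<in>B. norm x = 1 \<and> (\<exists>c. A *v x = c *\<^sub>R x))" for B
  have ind: "independent B" if "P B" for B
    using that by (intro pairwise_orthogonal_independent) (auto simp: P_def)
  have card_le: "card B \<le> CARD('n)" if "P B" for B
    using independent_bound[OF ind[OF that]] by simp
  have "P {}" by (simp add: P_def)
  then obtain B where B: "P B" and max: "\<And>C. P C \<Longrightarrow> card C \<le> card B"
    using ex_has_greatest_nat[of P "{}" card "Suc CARD('n)"] card_le le_imp_less_Suc by metis
  have fin: "finite B" using ind[OF B] independent_bound by blast
  have "span B = UNIV"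
  proof (rule ccontr)
    assume "span B \<noteq> UNIV"
    then obtain z where z: "z \<noteq> 0" "\<And>x. x \<in> span B \<Longrightarrow> z \<bullet> x = 0"
      using span_not_UNIV_orthogonal by blast
    define S where "S = {y. \<forall>x\<in>B. x \<bullet> y = 0}"
    have "subspace S" by (auto simp: S_def subspace_def inner_add_right)
    moreover have "A *v y \<in> S" if "y \<in> S" for y
    proof -
      have "x \<bullet> (A *v y) = 0" if "x \<in> B" for x
      proof -
        obtain c where "A *v x = c *\<^sub>R x" using B \<open>x \<in> B\<close> by (auto simp: P_def)
        then show ?thesis using \<open>y \<in> S\<close> \<open>x \<in> B\<close>
          by (simp add: symmetric_matrix_dot[OF sym] S_def)
      qed
      then show ?thesis by (simp add: S_def)
    qed
    moreover have "z \<in> S" using z by (auto simp: S_def inner_commute span_base)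
    ultimately obtain x c where x: "x \<in> S" "norm x = 1" "A *v x = c *\<^sub>R x"
      using symmetric_eigenvector_exists[OF sym] z(1) by metis
    have "P (insert x B)"
      using B x by (auto simp: P_def pairwise_insert orthogonal_def S_def inner_commute)
    moreover have "x \<notin> B" using x by (auto simp: S_def)
    ultimately show False using max[of "insert x B"] fin by simp
  qed
  then have "card B = CARD('n)"
    using basis_card_eq_dim[of B UNIV] ind[OF B] by simp
  with B show thesis by (intro that[of B]) (auto simp: P_def)
qed

lemma matrix_mult_diag_mat:
  fixes Q :: "real^'n^'m"
  shows "(Q ** diag_mat d) $ i $ j = Q $ i $ j * d j"
  by (simp add: matrix_matrix_mult_def diag_mat_def if_distrib[of "\<lambda>x. _ * x"] cong: if_cong)

lemma diag_mat_mult_matrix: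
  fixes Q :: "real^'m^'n"
  shows "(diag_mat d ** Q) $ i $ j = d i * Q $ i $ j"
  by (simp add: matrix_matrix_mult_def diag_mat_def if_distrib[of "\<lambda>x. x * _"] cong: if_cong)

lemma conjugate_diag_mat_nth:
  fixes Q :: "real^'n^'m"
  shows "(Q ** diag_mat d ** transpose Q) $ i $ j = (\<Sum>k\<in>UNIV. Q $ i $ k * d k * Q $ j $ k)"
  by (simp add: matrix_matrix_mult_def[of "Q ** diag_mat d"] matrix_mult_diag_mat transpose_def)

theorem symmetric_matrix_diagonalizable:
  fixes A :: "real^'n^'n"
  assumes "transpose A = A"
  obtains Q d where "orthogonal_matrix Q" "A = Q ** diag_mat d ** transpose Q"
proof -
  obtain B where B: "pairwise orthogonal B" "\<And>x. x \<in> B \<Longrightarrow> norm x = 1"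
    "\<And>x. x \<in> B \<Longrightarrow> \<exists>c. A *v x = c *\<^sub>R x" "card B = CARD('n)"
    using symmetric_orthonormal_eigenbasis[OF assms] by blast
  have "finite B" using B(4) by (metis card.infinite zero_less_card_finite less_irrefl)
  then obtain g :: "'n \<Rightarrow> real^'n" where g: "bij_betw g UNIV B"
    using B(4) finite_same_card_bij[of "UNIV :: 'n set" B] by auto
  have gB: "g j \<in> B" for j using g by (auto simp: bij_betw_def)
  have "\<exists>d. \<forall>j. A *v g j = d j *\<^sub>R g j" using B(3) gB by (intro choice) auto
  then obtain d where d: "\<And>j. A *v g j = d j *\<^sub>R g j" by blast
  define Q :: "real^'n^'n" where "Q = (\<chi> i j. g j $ i)"
  have col: "column j Q = g j" for j by (simp add: Q_def column_def vec_eq_iff)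
  have Q: "orthogonal_matrix Q"
    unfolding orthogonal_matrix_orthonormal_columns col
    using B(1,2) gB bij_betw_imp_inj_on[OF g] by (auto simp: pairwise_def inj_eq)
  have "A ** Q = Q ** diag_mat d"
  proof -
    have "(A ** Q) $ i $ j = (Q ** diag_mat d) $ i $ j" for i j
    proof -
      have "(A ** Q) $ i $ j = (A *v g j) $ i"
        by (simp add: matrix_matrix_mult_def matrix_vector_mult_def Q_def)
      also have "\<dots> = (Q ** diag_mat d) $ i $ j"
        by (simp add: d matrix_mult_diag_mat Q_def)
      finally show ?thesis .
    qed
    then show ?thesis by (simp add: vec_eq_iff)
  qed
  then have "Q ** diag_mat d ** transpose Q = A ** (Q ** transpose Q)"
    by (simp add: matrix_mul_assoc)
  also have "\<dots> = A" using Q by (simp add: orthogonal_matrix_def)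
  finally show thesis using Q that by metis
qed

text \<open>
  Well-definedness of \<open>f(A)\<close>. Two diagonalisations are linked by \<open>U = Q'\<^sup>T Q\<close> with
  \<open>U D = D' U\<close>, which says entrywise that \<open>d j = d' i\<close> wherever \<open>U\<close> does not vanish; this survives
  the application of \<open>f\<close> to both diagonals.
\<close>

lemma mat_fun_eqI:
  fixes A Q :: "real^'n^'n"
  assumes Q: "orthogonal_matrix Q" and A: "A = Q ** diag_mat d ** transpose Q"
  shows "mat_fun f A = Q ** diag_mat (\<lambda>i. f (d i)) ** transpose Q"
  unfolding mat_fun_def
proof (rule the_equality)
  fix B :: "real^'n^'n"
  assume "\<exists>Q d. orthogonal_matrix Q \<and> A = Q ** diag_mat d ** transpose Q
      \<and> B = Q ** diag_mat (\<lambda>i. f (d i)) ** transpose Q"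
  then obtain Q' d' where Q': "orthogonal_matrix Q'" and A': "A = Q' ** diag_mat d' ** transpose Q'"
    and B: "B = Q' ** diag_mat (\<lambda>i. f (d' i)) ** transpose Q'" by blast
  define U where "U = transpose Q' ** Q"
  have inv: "transpose Q ** Q = mat 1" "Q ** transpose Q = mat 1"
    "transpose Q' ** Q' = mat 1" "Q' ** transpose Q' = mat 1"
    using Q Q' by (auto simp: orthogonal_matrix_def)
  \<comment> \<open>Intertwining of diagonal matrices by \<open>U\<close> is equality of the conjugated matrices; it is used
    for the eigenvalues and for their images under \<open>f\<close>.\<close>
  have swap: "U ** diag_mat a = diag_mat b ** U \<longleftrightarrow>
      Q ** diag_mat a ** transpose Q = Q' ** diag_mat b ** transpose Q'" (is "?l \<longleftrightarrow> ?r") for a b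
  proof
    assume ?l
    then have "Q' ** (U ** diag_mat a) ** transpose Q = Q' ** (diag_mat b ** U) ** transpose Q"
      by simp
    moreover have "Q' ** (U ** diag_mat a) ** transpose Q
        = (Q' ** transpose Q') ** Q ** diag_mat a ** transpose Q"
      by (simp add: U_def matrix_mul_assoc)
    moreover have "Q' ** (diag_mat b ** U) ** transpose Q
        = Q' ** diag_mat b ** transpose Q' ** (Q ** transpose Q)"
      by (simp add: U_def matrix_mul_assoc)
    ultimately show ?r by (simp add: inv)
  next
    assume ?r
    then have "transpose Q' ** (Q ** diag_mat a ** transpose Q) ** Q
        = transpose Q' ** (Q' ** diag_mat b ** transpose Q') ** Q" by simp
    moreover have "transpose Q' ** (Q ** diag_mat a ** transpose Q) ** Q
        = U ** diag_mat a ** (transpose Q ** Q)"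
      by (simp add: U_def matrix_mul_assoc)
    moreover have "transpose Q' ** (Q' ** diag_mat b ** transpose Q') ** Q
        = (transpose Q' ** Q') ** diag_mat b ** U"
      by (simp add: U_def matrix_mul_assoc)
    ultimately show ?l by (simp add: inv)
  qed
  have "U ** diag_mat d = diag_mat d' ** U" using A A' swap by metis
  then have "U $ i $ j * d j = d' i * U $ i $ j" for i j
    by (metis matrix_mult_diag_mat diag_mat_mult_matrix)
  then have "U $ i $ j = 0 \<or> d j = d' i" for i j
    by (metis mult.commute mult_left_cancel)
  then have "U $ i $ j * f (d j) = f (d' i) * U $ i $ j" for i j
    by (metis mult.commute mult_zero_left)
  then have "U ** diag_mat (\<lambda>i. f (d i)) = diag_mat (\<lambda>i. f (d' i)) ** U"
    by (simp add: vec_eq_iff matrix_mult_diag_mat diag_mat_mult_matrix)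
  then show "B = Q ** diag_mat (\<lambda>i. f (d i)) ** transpose Q"
    using B swap by metis
qed (use assms in blast)

text \<open>
  Both lists are the multiset of roots of the characteristic polynomial.
\<close>

lemma eigenvalue_list_mset_unique:
  fixes A Q :: "real^'n^'n"
  assumes Q: "orthogonal_matrix Q" and A: "A = Q ** diag_mat d ** transpose Q"
    and l: "eigenvalue_list A l"
  shows "image_mset l (mset_set UNIV) = image_mset d (mset_set UNIV)"
proof -
  have inv: "Q ** transpose Q = mat 1" using Q by (simp add: orthogonal_matrix_def)
  have char: "det (mat t - A) = (\<Prod>i\<in>UNIV. t - d i)" for t
  proof -
    have "mat t - A = Q ** diag_mat (\<lambda>i. t - d i) ** transpose Q"
    proof -
      have "(\<Sum>k\<in>UNIV. Q $ i $ k * Q $ j $ k) = (mat 1 :: real^'n^'n) $ i $ j" for i j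
        by (simp add: inv[symmetric] matrix_matrix_mult_def transpose_def)
      moreover have "(mat t :: real^'n^'n) $ i $ j = t * (mat 1 :: real^'n^'n) $ i $ j" for i j
        by (simp add: mat_def)
      ultimately show ?thesis
        by (simp add: vec_eq_iff A conjugate_diag_mat_nth algebra_simps sum_subtractf
            flip: sum_distrib_left)
    qed
    then have "det (mat t - A) = det (diag_mat (\<lambda>i. t - d i)) * det (Q ** transpose Q)"
      by (simp add: det_mul)
    also have "\<dots> = (\<Prod>i\<in>UNIV. t - d i)"
      by (simp add: inv det_diagonal diag_mat_def)
    finally show ?thesis .
  qed
  define pl where "pl u = (\<Prod>i\<in>UNIV. [:- u i, 1:])" for u :: "'n \<Rightarrow> real"
  have "poly (pl l) = poly (pl d)"
    using l char by (auto simp: pl_def poly_prod eigenvalue_list_def fun_eq_iff)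
  then have "proots (pl l) = proots (pl d)" by (simp add: poly_eq_poly_eq_iff)
  moreover have "proots (pl u) = image_mset u (mset_set UNIV)" for u
    by (simp add: pl_def proots_prod sum_unfold_sum_mset)
  ultimately show ?thesis by simp
qed

section \<open>The projection onto the column space of a frame\<close>

text \<open>
  The orthogonal projection onto the column space when the columns of \<open>W\<close> are orthonormal.
\<close>

definition frame_proj :: "real^'b^'n \<Rightarrow> real^'n^'n" where
  "frame_proj W = W ** transpose W"

lemma frame_proj_nth: "frame_proj W $ i $ j = (\<Sum>k\<in>UNIV. W $ i $ k * W $ j $ k)"
  by (simp add: frame_proj_def matrix_matrix_mult_def transpose_def)

lemma frame_proj_sym: "frame_proj W $ i $ j = frame_proj W $ j $ i"
  by (simp add: frame_proj_nth mult.commute)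

lemma frame_proj_nth_measurable [measurable]:
  "(\<lambda>W. frame_proj W $ i $ j) \<in> borel_measurable borel"
  unfolding frame_proj_nth by (intro borel_measurable_continuous_onI continuous_intros)

lemma frame_proj_mult:
  fixes Q :: "real^'n^'n"
  shows "frame_proj (Q ** W) = Q ** frame_proj W ** transpose Q"
  by (simp add: frame_proj_def matrix_transpose_mul matrix_mul_assoc)

text \<open>
  The diagonal of \<open>P\<^sup>2 = P\<close>, for symmetric \<open>P\<close>.
\<close>

lemma frame_proj_row_squares:
  assumes "orthonormal_columns W"
  shows "(\<Sum>j\<in>UNIV. (frame_proj W $ i $ j)\<^sup>2) = frame_proj W $ i $ i"
proof -
  have "frame_proj W ** frame_proj W = W ** (transpose W ** W) ** transpose W"
    by (simp add: frame_proj_def matrix_mul_assoc)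
  also have "\<dots> = frame_proj W"
    using assms by (simp add: orthonormal_columns_def frame_proj_def)
  finally have "(frame_proj W ** frame_proj W) $ i $ i = frame_proj W $ i $ i" by simp
  moreover have "(frame_proj W ** frame_proj W) $ i $ i = (\<Sum>j\<in>UNIV. (frame_proj W $ i $ j)\<^sup>2)"
    unfolding matrix_matrix_mult_def power2_eq_square
    by (simp, intro sum.cong refl arg_cong2[where f = "(*)"] frame_proj_sym)
  ultimately show ?thesis by simp
qed

lemma frame_proj_trace:
  fixes W :: "real^'b^'n"
  assumes "orthonormal_columns W"
  shows "(\<Sum>i\<in>UNIV. frame_proj W $ i $ i) = real CARD('b)"
proof -
  have "trace (W ** transpose W) = trace (transpose W ** W)" by (rule trace_mul_sym)
  then show ?thesis
    using assms by (simp add: orthonormal_columns_def frame_proj_def trace_I) (simp add: trace_def)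
qed

lemma frame_proj_sq_le: 
  assumes "orthonormal_columns W"
  shows "(frame_proj W $ i $ j)\<^sup>2 \<le> frame_proj W $ i $ i"
  unfolding frame_proj_row_squares[OF assms, symmetric] by (intro member_le_sum) auto

lemma frame_proj_bounds:
  assumes "orthonormal_columns W"
  shows "frame_proj W $ i $ i \<le> 1" "\<bar>frame_proj W $ i $ j\<bar> \<le> 1"
proof -
  have *: "p \<le> 1" if "p\<^sup>2 \<le> p" for p :: real
  proof (rule ccontr)
    assume "\<not> p \<le> 1"
    then have "p * 1 < p * p" by (intro mult_strict_left_mono) auto
    with that show False by (simp add: power2_eq_square)
  qed
  show 1: "frame_proj W $ i $ i \<le> 1" using *[OF frame_proj_sq_le[OF assms, of i i]] .
  have "(frame_proj W $ i $ j)\<^sup>2 \<le> 1" using frame_proj_sq_le[OF assms, of i j] 1 by linarith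
  then show "\<bar>frame_proj W $ i $ j\<bar> \<le> 1" by (simp add: abs_square_le_1)
qed

text \<open>
  The diagonal entries are at most 1 and add up to \<open>b = n\<close>, so all are 1; then the row sums of
  squares leave no room for off-diagonal entries. This avoids inverting \<open>W\<close>, whose two index types
  differ.
\<close>

lemma frame_proj_square:
  fixes W :: "real^'b^'n"
  assumes "CARD('b) = CARD('n)" and W: "orthonormal_columns W"
  shows "frame_proj W = mat 1"
proof -
  have "(\<Sum>i\<in>UNIV. 1 - frame_proj W $ i $ i) = 0"
    using frame_proj_trace[OF W] assms(1) by (simp add: sum_subtractf)
  then have d: "frame_proj W $ i $ i = 1" for i
    using frame_proj_bounds(1)[OF W] by (simp add: sum_nonneg_eq_0_iff)
  have "frame_proj W $ i $ j = 0" if "i \<noteq> j" for i j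
  proof -
    have "(\<Sum>j\<in>UNIV. (frame_proj W $ i $ j)\<^sup>2)
        = (frame_proj W $ i $ i)\<^sup>2 + (\<Sum>j\<in>UNIV - {i}. (frame_proj W $ i $ j)\<^sup>2)"
      by (intro sum.remove) auto
    then have "(\<Sum>j\<in>UNIV - {i}. (frame_proj W $ i $ j)\<^sup>2) = 0"
      using frame_proj_row_squares[OF W, of i] by (simp add: d)
    then show ?thesis using that by (auto simp: sum_nonneg_eq_0_iff)
  qed
  then show ?thesis using d by (simp add: vec_eq_iff mat_def)
qed

section \<open>Second moments of a Haar distributed projection\<close>

lemma orthonormal_columns_borel:
  "{W :: real^'b^'n. orthonormal_columns W} \<in> sets borel"
proof -
  have "continuous_on UNIV (\<lambda>W :: real^'b^'n. transpose W ** W)"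
    unfolding matrix_matrix_mult_def transpose_def by (intro continuous_intros)
  then have "closed ((\<lambda>W :: real^'b^'n. transpose W ** W) -` {mat 1})"
    by (intro closed_vimage) auto
  then show ?thesis
    by (simp add: orthonormal_columns_def vimage_def borel_closed)
qed

locale random_frame = prob_space D for D :: "(real^'b^'n) measure" +
  assumes sets_D [measurable_cong, simp]: "sets D = sets borel"
    and AE_orthonormal: "AE W in D. orthonormal_columns W"
begin

lemma integrable_bounded_on_frames:
  fixes h :: "real^'b^'n \<Rightarrow> real"
  assumes [measurable]: "h \<in> borel_measurable borel"
    and "\<And>W. orthonormal_columns W \<Longrightarrow> \<bar>h W\<bar> \<le> c"
  shows "integrable D h"
proof (rule integrable_const_bound)
  show "AE W in D. norm (h W) \<le> c"
    using AE_orthonormal by eventually_elim (use assms(2) in auto)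
qed measurable

lemma integrable_frame_proj [simp]: "integrable D (\<lambda>W. frame_proj W $ i $ j)"
  by (intro integrable_bounded_on_frames[where c = 1]) (auto intro: frame_proj_bounds)

lemma integrable_frame_proj_mult [simp]:
  "integrable D (\<lambda>W. frame_proj W $ i $ j * frame_proj W $ k $ l)"
  by (intro integrable_bounded_on_frames[where c = 1])
    (auto intro!: mult_le_one simp: abs_mult frame_proj_bounds)

lemma integrable_frame_proj_power2 [simp]:
  "integrable D (\<lambda>W. (frame_proj W $ i $ j)\<^sup>2)"
  unfolding power2_eq_square by simp

end

locale haar_frame = random_frame D for D :: "(real^'b^'n) measure" +
  assumes invariant: "\<And>Q. orthogonal_matrix Q \<Longrightarrow> distr D borel (\<lambda>W. Q ** W) = D"
begin

lemma expectation_orthogonal_mult: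
  fixes h :: "real^'b^'n \<Rightarrow> real"
  assumes Q: "orthogonal_matrix Q" and [measurable]: "h \<in> borel_measurable borel"
  shows "expectation (\<lambda>W. h (Q ** W)) = expectation h"
proof -
  have "continuous_on UNIV (\<lambda>W :: real^'b^'n. Q ** W)"
    unfolding matrix_matrix_mult_def by (intro continuous_intros)
  then have [measurable]: "(\<lambda>W. Q ** W) \<in> measurable D borel"
    by (simp add: borel_measurable_continuous_onI cong: measurable_cong_sets)
  have "expectation (\<lambda>W. h (Q ** W)) = integral\<^sup>L (distr D borel (\<lambda>W. Q ** W)) h"
    by (rule integral_distr[symmetric]) auto
  then show ?thesis using invariant[OF Q] by simp
qed

text \<open>
  Rotational symmetry in the form in which it is used: every unit vector is the image of a
  coordinate vector under some orthogonal matrix.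
\<close>

lemma expectation_quadratic_form:
  fixes h :: "real \<Rightarrow> real"
  assumes "norm x = 1" and [measurable]: "h \<in> borel_measurable borel"
  shows "expectation (\<lambda>W. h (x \<bullet> (frame_proj W *v x))) = expectation (\<lambda>W. h (frame_proj W $ k $ k))"
proof -
  obtain A where A: "orthogonal_matrix A" "A *v (axis k 1) = x"
    using orthogonal_matrix_exists_basis[OF assms(1)] by blast
  have "x \<bullet> (frame_proj W *v x) = frame_proj (transpose A ** W) $ k $ k"
    for W :: "real^'b^'n"
  proof -
    have "frame_proj (transpose A ** W) $ k $ k
        = (\<Sum>i\<in>UNIV. (\<Sum>j\<in>UNIV. A $ j $ k * frame_proj W $ j $ i) * A $ i $ k)"
      by (simp only: frame_proj_mult) (simp add: matrix_matrix_mult_def transpose_def)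
    also have "\<dots> = (\<Sum>i\<in>UNIV. (\<Sum>j\<in>UNIV. x $ j * frame_proj W $ j $ i) * x $ i)"
      using A(2) by (auto simp: matrix_vector_mult_basis column_def)
    also have "\<dots> = (\<Sum>j\<in>UNIV. \<Sum>i\<in>UNIV. x $ j * frame_proj W $ j $ i * x $ i)"
      unfolding sum_distrib_right by (rule sum.swap)
    also have "\<dots> = x \<bullet> (frame_proj W *v x)"
      by (simp add: inner_vec_def matrix_vector_mult_def sum_distrib_left mult.assoc)
    finally show ?thesis by simp
  qed
  then show ?thesis
    using expectation_orthogonal_mult[of "transpose A" "\<lambda>W. h (frame_proj W $ k $ k)"] A(1) by simp
qed

lemma expectation_diag_eq:
  fixes h :: "real \<Rightarrow> real"
  assumes "h \<in> borel_measurable borel"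
  shows "expectation (\<lambda>W. h (frame_proj W $ i $ i)) = expectation (\<lambda>W. h (frame_proj W $ k $ k))"
proof -
  have "axis i 1 \<bullet> (frame_proj W *v axis i 1) = frame_proj W $ i $ i" for W :: "real^'b^'n"
    by (simp add: matrix_vector_mult_basis column_def inner_axis')
  then show ?thesis
    using expectation_quadratic_form[OF _ assms, of "axis i 1" k] by simp
qed

lemma expectation_diag: "expectation (\<lambda>W. frame_proj W $ i $ i) = real CARD('b) / real CARD('n)"
proof -
  have "real CARD('b) = expectation (\<lambda>W. \<Sum>k\<in>UNIV. frame_proj W $ k $ k)"
  proof -
    have "expectation (\<lambda>W. \<Sum>k\<in>UNIV. frame_proj W $ k $ k) = expectation (\<lambda>_. real CARD('b))"
      by (intro integral_cong_AE)
        (use AE_orthonormal in \<open>auto elim!: eventually_mono simp: frame_proj_trace\<close>)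
    then show ?thesis by (simp add: prob_space)
  qed
  also have "\<dots> = (\<Sum>k\<in>UNIV. expectation (\<lambda>W. frame_proj W $ k $ k))" by simp
  also have "\<dots> = (\<Sum>k\<in>(UNIV::'n set). expectation (\<lambda>W. frame_proj W $ i $ i))"
    by (intro sum.cong refl expectation_diag_eq[where h = "\<lambda>x. x"]) auto
  finally show ?thesis by (simp add: field_simps)
qed

lemma expectation_permute:
  assumes "bij p"
  shows "expectation (\<lambda>W. frame_proj W $ p i $ p i * frame_proj W $ p j $ p j)
    = expectation (\<lambda>W. frame_proj W $ i $ i * frame_proj W $ j $ j)"
proof -
  define Q :: "real^'n^'n" where "Q = (\<chi> i j. if j = p i then 1 else 0)"
  have row: "row i Q = axis (p i) 1" for i
    by (simp add: Q_def row_def vec_eq_iff axis_def)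
  have Q: "orthogonal_matrix Q"
    unfolding orthogonal_matrix_orthonormal_rows row
    using assms by (auto simp: orthogonal_def inner_axis_axis bij_def inj_eq)
  have "(Q ** W) $ i $ j = W $ p i $ j" for i j and W :: "real^'b^'n"
    by (simp add: Q_def matrix_matrix_mult_def if_distrib[of "\<lambda>x. x * _"] cong: if_cong)
  then have "frame_proj (Q ** W) $ i $ j = frame_proj W $ p i $ p j" for i j and W :: "real^'b^'n"
    by (simp add: frame_proj_nth)
  then show ?thesis
    using expectation_orthogonal_mult[OF Q, of "\<lambda>W. frame_proj W $ i $ i * frame_proj W $ j $ j"]
    by simp
qed

text \<open>
  For \<open>x = (e\<^sub>i \<plusminus> e\<^sub>j)/\<surd>2\<close> one has \<open>x \<bullet> P x = (P\<^sub>i\<^sub>i + P\<^sub>j\<^sub>j \<plusminus> 2 P\<^sub>i\<^sub>j)/2\<close>.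
  Both squares have the expectation of \<open>P\<^sub>i\<^sub>i\<^sup>2\<close>, and in their sum the mixed terms
  \<open>(P\<^sub>i\<^sub>i + P\<^sub>j\<^sub>j) P\<^sub>i\<^sub>j\<close> cancel.
\<close>

lemma expectation_off_diag:
  assumes "i \<noteq> j"
  shows "expectation (\<lambda>W. (frame_proj W $ i $ i)\<^sup>2)
    = expectation (\<lambda>W. frame_proj W $ i $ i * frame_proj W $ j $ j)
      + 2 * expectation (\<lambda>W. (frame_proj W $ i $ j)\<^sup>2)"
proof -
  define x :: "real \<Rightarrow> real^'n" where "x s = (1 / sqrt 2) *\<^sub>R (axis i 1 + s *\<^sub>R axis j 1)" for s :: real
  let ?a = "expectation (\<lambda>W. (frame_proj W $ i $ i)\<^sup>2)"
  have form: "x s \<bullet> (frame_proj W *v x s)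
      = (frame_proj W $ i $ i + frame_proj W $ j $ j + 2 * s * frame_proj W $ i $ j) / 2"
    if "s\<^sup>2 = 1" for s and W :: "real^'b^'n"
  proof -
    have "s * (s * y) = y" for y using that by (simp add: power2_eq_square mult.assoc[symmetric])
    then show ?thesis
      by (simp add: x_def matrix_vector_mult_scaleR matrix_vector_right_distrib inner_add_left
        inner_add_right matrix_vector_mult_basis column_def inner_axis' frame_proj_sym[of W j i]
        algebra_simps add_divide_distrib)
  qed
  have norm: "norm (x s) = 1" if "s\<^sup>2 = 1" for s
    using that assms unfolding norm_eq_1 x_def
    by (simp add: inner_add_left inner_add_right inner_axis_axis power2_eq_square)
  have ex: "expectation (\<lambda>W. ((frame_proj W $ i $ i + frame_proj W $ j $ j
      + 2 * s * frame_proj W $ i $ j) / 2)\<^sup>2) = ?a" if "s\<^sup>2 = 1" for s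
    using expectation_quadratic_form[OF norm[OF that], of power2 i] by (simp add: form[OF that])
  have jj: "expectation (\<lambda>W. (frame_proj W $ j $ j)\<^sup>2) = ?a"
    using expectation_diag_eq[of power2 j i] by simp
  have int: "integrable D (\<lambda>W. ((frame_proj W $ i $ i + frame_proj W $ j $ j
      + 2 * s * frame_proj W $ i $ j) / 2)\<^sup>2)" for s
    unfolding power2_eq_square by (simp add: algebra_simps add_divide_distrib)
  have "2 * ?a = expectation (\<lambda>W.
      ((frame_proj W $ i $ i + frame_proj W $ j $ j + 2 * 1 * frame_proj W $ i $ j) / 2)\<^sup>2
      + ((frame_proj W $ i $ i + frame_proj W $ j $ j + 2 * (-1) * frame_proj W $ i $ j) / 2)\<^sup>2)"
    by (subst Bochner_Integration.integral_add[OF int int]) (simp only: ex power_one power2_minus one_power2)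
  also have "\<dots> = expectation (\<lambda>W. ((frame_proj W $ i $ i)\<^sup>2 + (frame_proj W $ j $ j)\<^sup>2) / 2
      + frame_proj W $ i $ i * frame_proj W $ j $ j + 2 * (frame_proj W $ i $ j)\<^sup>2)"
    by (intro Bochner_Integration.integral_cong refl) (simp add: power2_eq_square field_simps)
  also have "\<dots> = ?a + expectation (\<lambda>W. frame_proj W $ i $ i * frame_proj W $ j $ j)
      + 2 * expectation (\<lambda>W. (frame_proj W $ i $ j)\<^sup>2)"
    by (simp add: jj)
  finally show ?thesis by simp
qed

text \<open>
  Multiply \<open>tr P = b\<close> by \<open>P\<^sub>i\<^sub>i\<close> and take expectations.
\<close>

lemma sum_diag_products:
  "(\<Sum>j\<in>UNIV. expectation (\<lambda>W. frame_proj W $ i $ i * frame_proj W $ j $ j))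
    = (real CARD('b))\<^sup>2 / real CARD('n)"
proof -
  have "(\<Sum>j\<in>UNIV. expectation (\<lambda>W. frame_proj W $ i $ i * frame_proj W $ j $ j))
      = expectation (\<lambda>W. \<Sum>j\<in>UNIV. frame_proj W $ i $ i * frame_proj W $ j $ j)" by simp
  also have "\<dots> = expectation (\<lambda>W. frame_proj W $ i $ i * real CARD('b))"
    by (intro integral_cong_AE)
      (use AE_orthonormal in \<open>auto elim!: eventually_mono simp: frame_proj_trace simp flip: sum_distrib_left\<close>)
  finally show ?thesis by (simp add: expectation_diag power2_eq_square)
qed

lemma sum_row_squares:
  "(\<Sum>j\<in>UNIV. expectation (\<lambda>W. (frame_proj W $ i $ j)\<^sup>2)) = real CARD('b) / real CARD('n)"
proof -
  have "(\<Sum>j\<in>UNIV. expectation (\<lambda>W. (frame_proj W $ i $ j)\<^sup>2))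
      = expectation (\<lambda>W. \<Sum>j\<in>UNIV. (frame_proj W $ i $ j)\<^sup>2)" by simp
  also have "\<dots> = expectation (\<lambda>W. frame_proj W $ i $ i)"
    by (intro integral_cong_AE)
      (use AE_orthonormal in \<open>auto elim!: eventually_mono simp: frame_proj_row_squares\<close>)
  finally show ?thesis by (simp add: expectation_diag)
qed

text \<open>
  Summing \<open>expectation_off_diag\<close> over \<open>j \<noteq> i\<close> turns its right-hand side into the two known row
  sums and leaves one linear equation for the diagonal moment.
\<close>

lemma second_moment_diag:
  "expectation (\<lambda>W. (frame_proj W $ i $ i)\<^sup>2)
    = real CARD('b) * (real CARD('b) + 2) / (real CARD('n) * (real CARD('n) + 2))"
proof -
  let ?n = "real CARD('n)" and ?b = "real CARD('b)"
  let ?a = "expectation (\<lambda>W. (frame_proj W $ i $ i)\<^sup>2)"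
  have "(\<Sum>j\<in>UNIV - {i}. ?a) = (\<Sum>j\<in>UNIV - {i}.
      expectation (\<lambda>W. frame_proj W $ i $ i * frame_proj W $ j $ j)
      + 2 * expectation (\<lambda>W. (frame_proj W $ i $ j)\<^sup>2))"
    by (intro sum.cong refl expectation_off_diag) auto
  also have "\<dots> = (?b\<^sup>2 / ?n - ?a) + 2 * (?b / ?n - ?a)"
    unfolding sum.distrib sum_distrib_left[symmetric]
    by (simp add: sum_diff1 sum_diag_products sum_row_squares) (simp add: power2_eq_square)
  finally have "(?n - 1) * ?a = (?b\<^sup>2 / ?n - ?a) + 2 * (?b / ?n - ?a)"
    by (simp add: card_Diff_singleton of_nat_diff Suc_leI)
  then have "(?n + 2) * ?a = ?b * (?b + 2) / ?n"
    by (simp add: algebra_simps add_divide_distrib power2_eq_square)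
  moreover have "?n + 2 > 0" by linarith
  ultimately have "?a = ?b * (?b + 2) / ?n / (?n + 2)"
    by (simp add: eq_divide_eq mult.commute)
  then show ?thesis by simp
qed

text \<open>
  Swapping \<open>j\<close> and \<open>k\<close> shows that the \<open>n - 1\<close> mixed moments in row \<open>i\<close> agree, so their sum
  determines each of them. The factor \<open>n - 1\<close> stays on the left to avoid a division by zero.
\<close>

lemma second_moment_mixed:
  assumes "i \<noteq> j"
  shows "(real CARD('n) - 1) * expectation (\<lambda>W. frame_proj W $ i $ i * frame_proj W $ j $ j)
    = (real CARD('b))\<^sup>2 / real CARD('n)
      - real CARD('b) * (real CARD('b) + 2) / (real CARD('n) * (real CARD('n) + 2))"
proof -
  let ?c = "\<lambda>j. expectation (\<lambda>W. frame_proj W $ i $ i * frame_proj W $ j $ j)"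
  have same: "?c k = ?c j" if "k \<noteq> i" for k
  proof -
    have "bij (Transposition.transpose j k)" by simp
    from expectation_permute[OF this, of i j] show ?thesis using that assms by simp
  qed
  have "(real CARD('n) - 1) * ?c j = (\<Sum>k\<in>UNIV - {i}. ?c j)"
    by (simp add: card_Diff_singleton of_nat_diff Suc_leI)
  also have "\<dots> = (\<Sum>k\<in>UNIV - {i}. ?c k)" by (intro sum.cong) (auto simp: same)
  also have "\<dots> = (real CARD('b))\<^sup>2 / real CARD('n) - expectation (\<lambda>W. (frame_proj W $ i $ i)\<^sup>2)"
    by (simp add: sum_diff1 sum_diag_products) (simp add: power2_eq_square)
  finally show ?thesis by (simp add: second_moment_diag)
qed

text \<open>
  Expanding the square gives \<open>(a - c) \<Sum> g\<^sub>i\<^sup>2 + (c - b\<^sup>2/n\<^sup>2) (\<Sum> g\<^sub>i)\<^sup>2\<close> with the moments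
  \<open>a\<close> and \<open>c\<close>. The second coefficient is \<open>-1/n\<close> times the first, as it must be because a constant \<open>g\<close>
  has the constant sum \<open>g b\<close>. For \<open>n = 1\<close> both sides vanish, the right one through division by zero.
\<close>

lemma variance_diag_form:
  fixes g :: "'n \<Rightarrow> real"
  shows "variance (\<lambda>W. \<Sum>i\<in>UNIV. g i * frame_proj W $ i $ i)
    = 2 * real CARD('b) * (real CARD('n) - real CARD('b))
        / (real CARD('n) * (real CARD('n) + 2) * (real CARD('n) - 1))
      * ((\<Sum>i\<in>UNIV. (g i)\<^sup>2) - (\<Sum>i\<in>UNIV. g i)\<^sup>2 / real CARD('n))"
proof -
  let ?n = "real CARD('n)" and ?b = "real CARD('b)"
  let ?Y = "\<lambda>W :: real^'b^'n. \<Sum>i\<in>UNIV. g i * frame_proj W $ i $ i"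
  let ?c = "\<lambda>i j. expectation (\<lambda>W. frame_proj W $ i $ i * frame_proj W $ j $ j)"
  define a where "a = ?b * (?b + 2) / (?n * (?n + 2))"
  define c where "c = (?b\<^sup>2 / ?n - a) / (?n - 1)"
  have aii: "?c i i = a" for i
    using second_moment_diag[of i] by (simp add: a_def power2_eq_square)
  have mean: "expectation ?Y = ?b / ?n * (\<Sum>i\<in>UNIV. g i)"
    by (simp add: expectation_diag flip: sum_distrib_right sum_divide_distrib)
  have sq: "(?Y W)\<^sup>2 = (\<Sum>i\<in>UNIV. \<Sum>j\<in>UNIV. g i * g j * (frame_proj W $ i $ i * frame_proj W $ j $ j))"
    for W
    by (simp add: power2_eq_square sum_product mult_ac)
  have int: "integrable D (\<lambda>W. (?Y W)\<^sup>2)" unfolding sq by simp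
  have "variance ?Y = expectation (\<lambda>W. (?Y W)\<^sup>2) - (expectation ?Y)\<^sup>2"
    by (rule variance_eq) (use int in simp_all)
  also have "expectation (\<lambda>W. (?Y W)\<^sup>2) = (\<Sum>i\<in>UNIV. \<Sum>j\<in>UNIV. g i * g j * ?c i j)"
    unfolding sq by simp
  finally have var: "variance ?Y
      = (\<Sum>i\<in>UNIV. \<Sum>j\<in>UNIV. g i * g j * ?c i j) - (?b / ?n * (\<Sum>i\<in>UNIV. g i))\<^sup>2"
    by (simp only: mean)
  show ?thesis
  proof (cases "CARD('n) = 1")
    case True
    then obtain k :: 'n where k: "UNIV = {k}" by (metis card_1_singletonE)
    have sum1: "(\<Sum>j\<in>UNIV. u j) = u k" for u :: "'n \<Rightarrow> real" unfolding k by simp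
    have "a = ?b\<^sup>2 / ?n" using sum_diag_products[of k] by (simp only: sum1 aii)
    then have "variance ?Y = 0"
      by (subst var) (simp add: sum1 aii True power2_eq_square)
    then show ?thesis using True by simp
  next
    case False
    then have n: "?n > 1" using less_Suc_eq[of 1 "CARD('n)"] by (simp add: Suc_lessI)
    have cij: "?c i j = (if i = j then (a - c) else 0) + c" for i j
    proof (cases "i = j")
      case False
      have "(?n - 1) * ?c i j = ?b\<^sup>2 / ?n - a"
        using second_moment_mixed[OF False] by (simp only: a_def)
      then show ?thesis using n False by (simp add: c_def eq_divide_eq mult.commute)
    qed (simp add: aii)
    have "(\<Sum>i\<in>UNIV. \<Sum>j\<in>UNIV. g i * g j * ?c i j)
        = (\<Sum>i\<in>UNIV. (g i)\<^sup>2 * (a - c) + c * (g i * (\<Sum>j\<in>UNIV. g j)))"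
      unfolding cij
      by (intro sum.cong refl)
        (simp add: distrib_left sum.distrib if_distrib[of "\<lambda>x. _ * x"] power2_eq_square
          sum_distrib_left mult_ac cong: if_cong)
    also have "\<dots> = (a - c) * (\<Sum>i\<in>UNIV. (g i)\<^sup>2) + c * (\<Sum>i\<in>UNIV. g i)\<^sup>2"
      by (simp add: sum.distrib power2_eq_square sum_distrib_left sum_distrib_right mult_ac)
    finally have off: "(\<Sum>i\<in>UNIV. \<Sum>j\<in>UNIV. g i * g j * ?c i j)
        = (a - c) * (\<Sum>i\<in>UNIV. (g i)\<^sup>2) + c * (\<Sum>i\<in>UNIV. g i)\<^sup>2" .
    have "variance ?Y = (a - c) * (\<Sum>i\<in>UNIV. (g i)\<^sup>2) + (c - (?b / ?n)\<^sup>2) * (\<Sum>i\<in>UNIV. g i)\<^sup>2"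
      unfolding var off by (simp add: power_mult_distrib power_divide left_diff_distrib)
    also have "a - c = 2 * ?b * (?n - ?b) / (?n * (?n + 2) * (?n - 1))"
    proof -
      have "a - c = (?n * a - ?b\<^sup>2 / ?n) / (?n - 1)"
        using n by (simp add: c_def field_simps)
      also have "?n * a - ?b\<^sup>2 / ?n = 2 * ?b * (?n - ?b) / (?n * (?n + 2))"
        using n by (simp add: a_def divide_simps power2_eq_square) (simp add: algebra_simps)
      finally show ?thesis by simp
    qed
    also have "c - (?b / ?n)\<^sup>2 = - (2 * ?b * (?n - ?b) / (?n * (?n + 2) * (?n - 1))) / ?n"
      using n by (simp add: a_def c_def divide_simps power2_eq_square) (simp add: algebra_simps)
    also have "K * S + - K / N * T = K * (S - T / N)" for K S N T :: real
      by (simp add: right_diff_distrib)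
    finally show ?thesis .
  qed
qed

end

section \<open>The trace sample\<close>

text \<open>
  By cyclicity of the trace the sample is linear in the projection.
\<close>

lemma mc_sample_frame_proj:
  fixes W :: "real^'b^'n"
  shows "mc_sample f A W = real CARD('n) / real CARD('b)
    * (\<Sum>i\<in>UNIV. \<Sum>j\<in>UNIV. mat_fun f A $ i $ j * frame_proj W $ j $ i)"
proof -
  have "trace (transpose W ** mat_fun f A ** W) = trace (transpose W ** (mat_fun f A ** W))"
    by (simp add: matrix_mul_assoc)
  also have "\<dots> = trace (mat_fun f A ** W ** transpose W)"
    by (rule trace_mul_sym)
  also have "\<dots> = trace (mat_fun f A ** frame_proj W)"
    by (simp add: frame_proj_def matrix_mul_assoc)
  finally show ?thesis by (simp add: mc_sample_def trace_def matrix_matrix_mult_def)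
qed

lemma mc_sample_measurable [measurable]:
  "(\<lambda>W :: real^'b^'n. mc_sample f A W) \<in> borel_measurable borel"
  unfolding mc_sample_frame_proj by measurable

lemma mc_sample_bounded:
  fixes A :: "real^'n^'n"
  obtains c where "\<And>W :: real^'b^'n. orthonormal_columns W \<Longrightarrow> \<bar>mc_sample f A W\<bar> \<le> c"
proof
  fix W :: "real^'b^'n"
  assume W: "orthonormal_columns W"
  have "\<bar>\<Sum>i\<in>UNIV. \<Sum>j\<in>UNIV. mat_fun f A $ i $ j * frame_proj W $ j $ i\<bar>
      \<le> (\<Sum>i\<in>UNIV. \<Sum>j\<in>UNIV. \<bar>mat_fun f A $ i $ j\<bar>)"
    by (intro sum_abs[THEN order_trans] sum_mono)
      (auto simp: abs_mult intro!: mult_left_le frame_proj_bounds[OF W])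
  then show "\<bar>mc_sample f A W\<bar>
      \<le> real CARD('n) / real CARD('b) * (\<Sum>i\<in>UNIV. \<Sum>j\<in>UNIV. \<bar>mat_fun f A $ i $ j\<bar>)"
    by (simp add: mc_sample_frame_proj abs_mult mult_left_mono divide_right_mono)
qed

lemma (in random_frame) mc_sample_integrable [simp]:
  "integrable D (mc_sample f A)" "integrable D (\<lambda>W. (mc_sample f A W)\<^sup>2)"
proof -
  obtain c where c: "\<And>W :: real^'b^'n. orthonormal_columns W \<Longrightarrow> \<bar>mc_sample f A W\<bar> \<le> c"
    using mc_sample_bounded[of f A] by blast
  show "integrable D (mc_sample f A)"
    using c by (intro integrable_bounded_on_frames) auto
  show "integrable D (\<lambda>W. (mc_sample f A W)\<^sup>2)"
  proof (intro integrable_bounded_on_frames)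
    fix W :: "real^'b^'n" assume "orthonormal_columns W"
    from power_mono[OF c[OF this] abs_ge_zero, of 2]
    show "\<bar>(mc_sample f A W)\<^sup>2\<bar> \<le> c\<^sup>2" by simp
  qed simp
qed

lemma (in random_frame) expectation_mc_sample:
  assumes mean: "\<And>i j. expectation (\<lambda>W. frame_proj W $ i $ j)
    = (if i = j then real CARD('b) / real CARD('n) else 0)"
  shows "expectation (mc_sample f A) = trace (mat_fun f A)"
proof -
  have "expectation (mc_sample f A) = real CARD('n) / real CARD('b)
      * (\<Sum>i\<in>UNIV. \<Sum>j\<in>UNIV. mat_fun f A $ i $ j * expectation (\<lambda>W. frame_proj W $ j $ i))"
    unfolding mc_sample_frame_proj[abs_def] by simp
  also have "\<dots> = trace (mat_fun f A)"
    by (simp add: mean trace_def if_distrib[of "\<lambda>x. _ * x"] sum_distrib_left cong: if_cong)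
  finally show ?thesis .
qed

lemma mc_sample_square_frame:
  fixes W :: "real^'b^'n"
  assumes "CARD('b) = CARD('n)" "orthonormal_columns W"
  shows "mc_sample f A W = trace (mat_fun f A)"
  using assms(1)
  by (simp add: mc_sample_frame_proj frame_proj_square[OF assms] mat_def trace_def
      if_distrib[of "\<lambda>x. _ * x"] cong: if_cong)

lemma mc_sample_diagonalized:
  fixes A Q :: "real^'n^'n" and W :: "real^'b^'n"
  assumes Q: "orthogonal_matrix Q" and A: "A = Q ** diag_mat d ** transpose Q"
  shows "mc_sample f A W = real CARD('n) / real CARD('b)
    * (\<Sum>i\<in>UNIV. f (d i) * frame_proj (transpose Q ** W) $ i $ i)"
proof -
  let ?D = "diag_mat (\<lambda>i. f (d i)) :: real^'n^'n" and ?U = "transpose Q ** W"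
  have "transpose W ** mat_fun f A ** W = transpose ?U ** (?D ** ?U)"
    by (simp add: mat_fun_eqI[OF assms] matrix_transpose_mul matrix_mul_assoc)
  then have "trace (transpose W ** mat_fun f A ** W) = trace (?D ** ?U ** transpose ?U)"
    using trace_mul_sym[of "transpose ?U" "?D ** ?U"] by (simp only:)
  also have "\<dots> = trace (?D ** frame_proj ?U)"
    by (simp only: frame_proj_def matrix_mul_assoc)
  finally show ?thesis by (simp add: mc_sample_def trace_def diag_mat_mult_matrix)
qed

lemma trace_mat_fun:
  fixes A Q :: "real^'n^'n"
  assumes Q: "orthogonal_matrix Q" and A: "A = Q ** diag_mat d ** transpose Q"
  shows "trace (mat_fun f A) = (\<Sum>i\<in>UNIV. f (d i))"
proof -
  have "trace (mat_fun f A) = trace (transpose Q ** (Q ** diag_mat (\<lambda>i. f (d i))))"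
    unfolding mat_fun_eqI[OF assms] by (rule trace_mul_sym)
  also have "\<dots> = trace (transpose Q ** Q ** diag_mat (\<lambda>i. f (d i)))"
    by (simp only: matrix_mul_assoc)
  finally show ?thesis
    using Q by (simp add: orthogonal_matrix_def) (simp add: trace_def diag_mat_def)
qed

text \<open>
  Rotating by \<open>Q\<^sup>T\<close> replaces \<open>A\<close> by its diagonal; then only the constants have to be matched. For
  \<open>n = 1\<close> the constants differ, but the factor measuring the spread of the values \<open>f (d i)\<close> is zero.
\<close>

lemma (in haar_frame) variance_mc_sample:
  fixes A Q :: "real^'n^'n"
  assumes Q: "orthogonal_matrix Q" and A: "A = Q ** diag_mat d ** transpose Q"
  shows "variance (mc_sample f A)
    = 2 * real CARD('n) / (real CARD('b) * (real CARD('n) + 2))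
      * (1 - (real CARD('b) - 1) / (real CARD('n) - 1))
      * ((\<Sum>i\<in>UNIV. (f (d i))\<^sup>2) - 1 / real CARD('n) * (\<Sum>i\<in>UNIV. f (d i))\<^sup>2)"
proof -
  let ?n = "real CARD('n)" and ?b = "real CARD('b)"
  let ?Y = "\<lambda>W :: real^'b^'n. \<Sum>i\<in>UNIV. f (d i) * frame_proj W $ i $ i"
  let ?S = "(\<Sum>i\<in>UNIV. (f (d i))\<^sup>2) - (\<Sum>i\<in>UNIV. f (d i))\<^sup>2 / ?n"
  let ?k = "2 * ?b * (?n - ?b) / (?n * (?n + 2) * (?n - 1))"
  have sample: "mc_sample f A = (\<lambda>W. ?n / ?b * ?Y (transpose Q ** W))"
    by (simp add: fun_eq_iff mc_sample_diagonalized[OF assms])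
  have QT: "orthogonal_matrix (transpose Q)" using Q by simp
  have mean: "expectation (mc_sample f A) = ?n / ?b * expectation ?Y"
    unfolding sample
    using expectation_orthogonal_mult[OF QT, of ?Y] by simp
  have "variance (mc_sample f A)
      = expectation (\<lambda>W. (?n / ?b)\<^sup>2 * (?Y (transpose Q ** W) - expectation ?Y)\<^sup>2)"
    by (intro Bochner_Integration.integral_cong refl, subst mean)
      (simp only: sample right_diff_distrib[symmetric] power_mult_distrib)
  also have "\<dots> = (?n / ?b)\<^sup>2 * variance ?Y"
    using expectation_orthogonal_mult[OF QT, of "\<lambda>W. (?Y W - expectation ?Y)\<^sup>2"] by simp
  also have "\<dots> = (?n / ?b)\<^sup>2 * ?k * ?S"
    by (simp only: variance_diag_form mult.assoc)
  also have "\<dots> = 2 * ?n / (?b * (?n + 2)) * (1 - (?b - 1) / (?n - 1)) * ?S"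
  proof (cases "CARD('n) = 1")
    case True
    then obtain k :: 'n where k: "UNIV = {k}" by (metis card_1_singletonE)
    have sum1: "(\<Sum>j\<in>UNIV. u j) = u k" for u :: "'n \<Rightarrow> real" unfolding k by simp
    have "?S = 0" using True by (simp add: sum1)
    then show ?thesis by (simp only: mult_zero_right)
  next
    case False
    then have n: "?n > 1" using less_Suc_eq[of 1 "CARD('n)"] by (simp add: Suc_lessI)
    have b: "?b > 0" by simp
    have "(?n / ?b)\<^sup>2 * ?k = 2 * ?n * (?n - ?b) / (?b * (?n + 2) * (?n - 1))"
    proof -
      have "(n / b)\<^sup>2 * (2 * b * x / (n * y * z)) = 2 * n * x / (b * y * z)"
        if "n \<noteq> 0" "b \<noteq> 0" for n b x y z :: real
        using that by (simp add: power2_eq_square mult_ac)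
      then show ?thesis using b by simp
    qed
    also have "\<dots> = 2 * ?n / (?b * (?n + 2)) * ((?n - ?b) / (?n - 1))" by simp
    also have "(?n - ?b) / (?n - 1) = 1 - (?b - 1) / (?n - 1)"
      using n by (simp add: field_simps)
    finally show ?thesis by (simp only:)
  qed
  finally show ?thesis by simp
qed

section \<open>Means of independent identically distributed variables\<close>

text \<open>
  Bienayme's identity: the centred variables are pairwise orthogonal in \<open>L\<^sup>2\<close>.
\<close>

lemma (in prob_space) variance_sum_indep:
  fixes X :: "'i \<Rightarrow> 'a \<Rightarrow> real"
  assumes I: "finite I" and indep: "indep_vars (\<lambda>_. borel) X I"
    and int: "\<And>i. i \<in> I \<Longrightarrow> integrable M (X i)"
    and int2: "\<And>i. i \<in> I \<Longrightarrow> integrable M (\<lambda>\<omega>. (X i \<omega>)\<^sup>2)"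
  shows "variance (\<lambda>\<omega>. \<Sum>i\<in>I. X i \<omega>) = (\<Sum>i\<in>I. variance (X i))"
proof -
  define Z where "Z i \<omega> = X i \<omega> - expectation (X i)" for i \<omega>
  have Z0: "expectation (Z i) = 0" if "i \<in> I" for i
    using int[OF that] by (simp add: Z_def[abs_def] prob_space)
  have Zint: "integrable M (Z i)" if "i \<in> I" for i
    using int[OF that] by (simp add: Z_def[abs_def])
  have Zind: "indep_vars (\<lambda>_. borel) Z I"
    unfolding Z_def[abs_def] by (rule indep_vars_compose2[OF indep]) auto
  have cross: "integrable M (\<lambda>\<omega>. Z i \<omega> * Z j \<omega>)
      \<and> expectation (\<lambda>\<omega>. Z i \<omega> * Z j \<omega>) = (if i = j then variance (X i) else 0)"
    if "i \<in> I" "j \<in> I" for i j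
  proof (cases "i = j")
    case True
    have "(\<lambda>\<omega>. Z i \<omega> * Z j \<omega>)
        = (\<lambda>\<omega>. (X i \<omega>)\<^sup>2 - 2 * expectation (X i) * X i \<omega> + (expectation (X i))\<^sup>2)"
      by (simp add: True Z_def fun_eq_iff power2_eq_square algebra_simps)
    then have "integrable M (\<lambda>\<omega>. Z i \<omega> * Z j \<omega>)"
      using int[OF that(1)] int2[OF that(1)] by simp
    then show ?thesis using True by (simp add: Z_def power2_eq_square)
  next
    case False
    have ind: "indep_vars (\<lambda>_. borel) Z {i, j}"
      using indep_vars_subset[OF Zind] that by simp
    have ints: "k \<in> {i, j} \<Longrightarrow> integrable M (Z k)" for k using Zint that by auto
    have "integrable M (\<lambda>\<omega>. \<Prod>k\<in>{i, j}. Z k \<omega>)"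
      by (rule indep_vars_integrable[OF _ ind ints]) auto
    moreover have "expectation (\<lambda>\<omega>. \<Prod>k\<in>{i, j}. Z k \<omega>) = (\<Prod>k\<in>{i, j}. expectation (Z k))"
      by (rule indep_vars_lebesgue_integral[OF _ ind ints]) auto
    ultimately show ?thesis using False that by (simp add: Z0)
  qed
  have "expectation (\<lambda>\<omega>. \<Sum>i\<in>I. X i \<omega>) = (\<Sum>i\<in>I. expectation (X i))"
    using int by simp
  then have "(\<Sum>i\<in>I. X i \<omega>) - expectation (\<lambda>\<omega>. \<Sum>i\<in>I. X i \<omega>) = (\<Sum>i\<in>I. Z i \<omega>)" for \<omega>
    by (simp add: Z_def sum_subtractf)
  then have "variance (\<lambda>\<omega>. \<Sum>i\<in>I. X i \<omega>) = expectation (\<lambda>\<omega>. \<Sum>i\<in>I. \<Sum>j\<in>I. Z i \<omega> * Z j \<omega>)"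
    by (simp only: power2_eq_square sum_product)
  also have "\<dots> = (\<Sum>i\<in>I. \<Sum>j\<in>I. expectation (\<lambda>\<omega>. Z i \<omega> * Z j \<omega>))"
    using cross by (subst Bochner_Integration.integral_sum; simp)
  also have "\<dots> = (\<Sum>i\<in>I. variance (X i))"
    using cross I by (intro sum.cong refl) (simp add: sum.delta)
  finally show ?thesis .
qed

text \<open>
  Extends Hoeffding's inequality to the degenerate interval \<open>a = b\<close>, where division by zero makes the
  bound equal to 2.
\<close>

lemma (in prob_space) Hoeffding_iid_mean:
  fixes X :: "'i \<Rightarrow> 'a \<Rightarrow> real"
  assumes I: "finite I" "I \<noteq> {}" and indep: "indep_vars (\<lambda>_. borel) X I"
    and distr: "\<And>i. i \<in> I \<Longrightarrow> distr M borel (X i) = distr M borel Y"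
    and Y [measurable]: "random_variable borel Y" and bnd: "AE \<omega> in M. Y \<omega> \<in> {a..b}"
    and \<epsilon>: "0 \<le> \<epsilon>"
  shows "prob {\<omega>\<in>space M. \<epsilon> \<le> \<bar>(\<Sum>i\<in>I. X i \<omega>) / card I - expectation Y\<bar>}
    \<le> 2 * exp (- (2 * real (card I) * \<epsilon>\<^sup>2 / (b - a)\<^sup>2))"
proof (cases "a < b")
  case True
  interpret Hoeffding_ineq_iid M I X Y a b "expectation Y"
    by unfold_locales (rule I indep Y bnd reflexive | erule distr)+
  show ?thesis using Hoeffding_ineq_abs_ge'[OF \<epsilon> True I(2)] by simp
next
  case False
  have "AE \<omega> in M. a \<le> b" using bnd by eventually_elim auto
  then have "a = b" using False by simp
  then show ?thesis by (simp add: order_trans[OF prob_le_1])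
qed

text \<open>
  The radius is the deviation at which Hoeffding's bound equals \<open>\<delta>\<close>. If \<open>a = b\<close> the radius is 0 and
  Hoeffding's bound is void, but then all variables are almost surely equal to \<open>a\<close>.
\<close>

lemma (in prob_space) Hoeffding_iid_mean_confidence:
  fixes X :: "'i \<Rightarrow> 'a \<Rightarrow> real"
  assumes I: "finite I" "I \<noteq> {}" and indep: "indep_vars (\<lambda>_. borel) X I"
    and distr: "\<And>i. i \<in> I \<Longrightarrow> distr M borel (X i) = distr M borel Y"
    and Y [measurable]: "random_variable borel Y" and bnd: "AE \<omega> in M. Y \<omega> \<in> {a..b}"
    and \<delta>: "0 < \<delta>" "\<delta> < 1"
  shows "1 - \<delta> \<le> prob {\<omega>\<in>space M. \<bar>(\<Sum>i\<in>I. X i \<omega>) / card I - expectation Y\<bar>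
    \<le> (b - a) * sqrt (ln (2 / \<delta>) / (2 * real (card I)))}"
proof -
  let ?Z = "\<lambda>\<omega>. \<bar>(\<Sum>i\<in>I. X i \<omega>) / card I - expectation Y\<bar>"
  let ?r = "(b - a) * sqrt (ln (2 / \<delta>) / (2 * real (card I)))"
  have [measurable]: "X i \<in> borel_measurable M" if "i \<in> I" for i
    using indep that by (auto simp: indep_vars_def)
  have c: "real (card I) > 0" using I by (simp add: card_gt_0_iff)
  have "AE \<omega> in M. a \<le> b" using bnd by eventually_elim auto
  then consider "a < b" | "a = b" by force
  then show ?thesis
  proof cases
    case 1
    have L: "ln (2 / \<delta>) > 0" using \<delta> by simp
    have r: "?r \<ge> 0" using 1 L c by simp
    have "?r\<^sup>2 = (b - a)\<^sup>2 * (ln (2 / \<delta>) / (2 * real (card I)))"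
      using L c by (simp add: power_mult_distrib)
    then have "2 * real (card I) * ?r\<^sup>2 / (b - a)\<^sup>2 = ln (2 / \<delta>)"
      using 1 c by simp
    then have "2 * exp (- (2 * real (card I) * ?r\<^sup>2 / (b - a)\<^sup>2)) = \<delta>"
      using \<delta> by (simp add: exp_minus)
    then have tail: "prob {\<omega>\<in>space M. ?r \<le> ?Z \<omega>} \<le> \<delta>"
      using Hoeffding_iid_mean[OF I indep distr Y bnd r] by simp
    have "1 - prob {\<omega>\<in>space M. ?r \<le> ?Z \<omega>} = prob (space M - {\<omega>\<in>space M. ?r \<le> ?Z \<omega>})"
      by (rule prob_compl[symmetric]) measurable
    also have "\<dots> \<le> prob {\<omega>\<in>space M. ?Z \<omega> \<le> ?r}"
      by (intro finite_measure_mono) auto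
    finally show ?thesis using tail by linarith
  next
    case 2
    have Yc: "AE \<omega> in M. Y \<omega> = a" using bnd 2 by auto
    have "expectation Y = expectation (\<lambda>_. a)"
      by (rule integral_cong_AE) (use Yc in auto)
    then have EY: "expectation Y = a" by (simp add: prob_space)
    have "AE \<omega> in M. X i \<omega> = a" if "i \<in> I" for i
    proof -
      have "AE x in distr M borel Y. x = a" using Yc by (simp add: AE_distr_iff)
      then have "AE x in distr M borel (X i). x = a" by (simp only: distr[OF that])
      then show ?thesis using that by (intro AE_distrD[of "X i" M borel]) auto
    qed
    then have "AE \<omega> in M. \<forall>i\<in>I. X i \<omega> = a"
      using I by (simp add: AE_finite_all)
    then have "AE \<omega> in M. ?Z \<omega> \<le> ?r"
      by eventually_elim (use c in \<open>simp add: EY 2\<close>)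
    then have "prob {\<omega>\<in>space M. ?Z \<omega> \<le> ?r} = 1"
      by (intro prob_Collect_eq_1[THEN iffD2]) auto
    then show ?thesis using \<delta> by simp
  qed
qed

section \<open>The Monte Carlo trace estimator\<close>

theorem theorem2p1:
  fixes A :: "real^'n^'n" and l :: "'n \<Rightarrow> real" and f :: "real \<Rightarrow> real"
    and M :: "'w measure" and V :: "'w \<Rightarrow> real^'b^'n"
    and Vs :: "nat \<Rightarrow> 'w \<Rightarrow> real^'b^'n" and q :: nat
  assumes b_le_n: "CARD('b) \<le> CARD('n)"
    and q_pos: "0 < q"
    and A_psd: "sym_psd A"
    and A_eig: "eigenvalue_list A l"
    and f_convex: "convex_on {0..} f"
    and f_C2: "C2_nonneg f"
    and M: "prob_space M"
    and V_rv: "V \<in> borel_measurable M"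
    and V_orth: "AE \<omega> in M. orthonormal_columns (V \<omega>)"
    and V_mean: "integral\<^sup>L M (\<lambda>\<omega>. V \<omega> ** transpose (V \<omega>))
                   = (real CARD('b) / real CARD('n)) *\<^sub>R (mat 1 :: real^'n^'n)"
    and Vs_indep: "prob_space.indep_vars M (\<lambda>_. borel) Vs {1..q}"
    and Vs_distr: "\<forall>i\<in>{1..q}. distr M borel (Vs i) = distr M borel V"
  shows
    "integral\<^sup>L M (\<lambda>\<omega>. mc_sample f A (V \<omega>)) = trace (mat_fun f A)
     \<and> (CARD('b) = CARD('n) \<longrightarrow>
          (\<forall>W::real^'b^'n. orthonormal_columns W \<longrightarrow>
             W ** transpose W = mat 1 \<and> mc_sample f A W = trace (mat_fun f A)))
     \<and> (haar_stiefel (distr M borel V) \<longrightarrow>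
          prob_space.variance M (\<lambda>\<omega>. mc_sample f A (V \<omega>))
            = 2 * real CARD('n) / (real CARD('b) * (real CARD('n) + 2))
              * (1 - (real CARD('b) - 1) / (real CARD('n) - 1))
              * ((\<Sum>i\<in>UNIV. (f (l i))\<^sup>2) - 1 / real CARD('n) * (trace (mat_fun f A))\<^sup>2))
     \<and> prob_space.variance M (\<lambda>\<omega>. mc_estimator q f A (\<lambda>i. Vs i \<omega>))
         = 1 / real q * prob_space.variance M (\<lambda>\<omega>. mc_sample f A (V \<omega>))
     \<and> (\<forall>lmin lmax. (AE \<omega> in M. mc_sample f A (V \<omega>) \<in> {lmin..lmax}) \<longrightarrow>
          (\<forall>\<epsilon>>0. measure M {\<omega>\<in>space M.
                \<epsilon> \<le> \<bar>mc_estimator q f A (\<lambda>i. Vs i \<omega>) - trace (mat_fun f A)\<bar>}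
              \<le> 2 * exp (- (2 * real q * \<epsilon>\<^sup>2 / (lmax - lmin)\<^sup>2)))
          \<and> (\<forall>\<delta>. 0 < \<delta> \<and> \<delta> < 1 \<longrightarrow>
              1 - \<delta> \<le> measure M {\<omega>\<in>space M.
                \<bar>mc_estimator q f A (\<lambda>i. Vs i \<omega>) - trace (mat_fun f A)\<bar>
                  \<le> (lmax - lmin) * sqrt (ln (2 / \<delta>) / (2 * real q))}))"
proof -
  interpret prob_space M by (rule M)
  let ?D = "distr M borel V"
  interpret D: random_frame ?D
  proof (intro random_frame.intro random_frame_axioms.intro)
    show "prob_space ?D" using V_rv by (rule prob_space_distr)
    have "{W :: real^'b^'n. orthonormal_columns W} \<in> sets borel"
      by (rule orthonormal_columns_borel)
    then show "AE W in ?D. orthonormal_columns W"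
      using V_orth V_rv by (simp add: AE_distr_iff)
  qed simp
  have to_D: "integral\<^sup>L M (\<lambda>\<omega>. h (V \<omega>)) = integral\<^sup>L ?D h"
    if "h \<in> borel_measurable borel" for h :: "real^'b^'n \<Rightarrow> real"
    using integral_distr[OF V_rv that] by simp
  have int_M: "integrable M (\<lambda>\<omega>. h (V \<omega>))"
    if "integrable ?D h" for h :: "real^'b^'n \<Rightarrow> real"
    using integrable_distr[OF V_rv that] .
  have mean: "D.expectation (\<lambda>W. frame_proj W $ i $ j)
      = (if i = j then real CARD('b) / real CARD('n) else 0)" for i j
  proof -
    \<comment> \<open>The integral of a non-integrable function is 0 by convention, so the prescribed nonzero mean
      entails integrability.\<close>
    have "integral\<^sup>L M (\<lambda>\<omega>. V \<omega> ** transpose (V \<omega>)) \<noteq> 0"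
      by (simp add: V_mean vec_eq_iff mat_def)
    then have "integrable M (\<lambda>\<omega>. frame_proj (V \<omega>))"
      unfolding frame_proj_def using not_integrable_integral_eq by blast
    then have "integral\<^sup>L M (\<lambda>\<omega>. frame_proj (V \<omega>) $ i $ j)
        = integral\<^sup>L M (\<lambda>\<omega>. frame_proj (V \<omega>)) $ i $ j"
      by (intro integral_bounded_linear[where T = "\<lambda>B. B $ i $ j"]
          bounded_linear_compose[OF bounded_linear_vec_nth bounded_linear_vec_nth])
    then show ?thesis
      unfolding to_D[OF frame_proj_nth_measurable, symmetric]
      by (simp add: frame_proj_def V_mean mat_def)
  qed
  have EX: "expectation (\<lambda>\<omega>. mc_sample f A (V \<omega>)) = trace (mat_fun f A)"
    using to_D[of "mc_sample f A"] D.expectation_mc_sample[OF mean] by simp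
  obtain Q d where Q: "orthogonal_matrix Q" and A: "A = Q ** diag_mat d ** transpose Q"
    using symmetric_matrix_diagonalizable[of A] A_psd by (auto simp: sym_psd_def)
  have sum_l: "(\<Sum>i\<in>UNIV. (f (l i))\<^sup>2) = (\<Sum>i\<in>UNIV. (f (d i))\<^sup>2)"
  proof -
    have "(\<Sum>x\<in>#image_mset l (mset_set UNIV). (f x)\<^sup>2) = (\<Sum>x\<in>#image_mset d (mset_set UNIV). (f x)\<^sup>2)"
      by (simp only: eigenvalue_list_mset_unique[OF Q A A_eig])
    then show ?thesis
      by (simp only: sum_unfold_sum_mset multiset.map_comp comp_def)
  qed
  have haar: "variance (\<lambda>\<omega>. mc_sample f A (V \<omega>))
      = 2 * real CARD('n) / (real CARD('b) * (real CARD('n) + 2))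
        * (1 - (real CARD('b) - 1) / (real CARD('n) - 1))
        * ((\<Sum>i\<in>UNIV. (f (l i))\<^sup>2) - 1 / real CARD('n) * (trace (mat_fun f A))\<^sup>2)"
    if "haar_stiefel ?D"
  proof -
    interpret H: haar_frame ?D
      by unfold_locales (use that in \<open>simp add: haar_stiefel_def\<close>)
    have "variance (\<lambda>\<omega>. mc_sample f A (V \<omega>)) = D.variance (mc_sample f A)"
      using to_D[of "mc_sample f A"]
        to_D[of "\<lambda>W. (mc_sample f A W - D.expectation (mc_sample f A))\<^sup>2"] by simp
    then show ?thesis
      by (simp only: H.variance_mc_sample[OF Q A] sum_l trace_mat_fun[OF Q A])
  qed
  let ?I = "{1..q}" and ?X = "\<lambda>i \<omega>. mc_sample f A (Vs i \<omega>)" and ?Y = "\<lambda>\<omega>. mc_sample f A (V \<omega>)"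
  have Vs_rv: "Vs i \<in> borel_measurable M" if "i \<in> ?I" for i
    using Vs_indep that by (auto simp: indep_vars_def)
  have Y_rv: "random_variable borel ?Y" using V_rv by simp
  have X_indep: "indep_vars (\<lambda>_. borel) ?X ?I"
    by (rule indep_vars_compose2[OF Vs_indep]) simp
  have X_distr: "distr M borel (?X i) = distr M borel ?Y" if "i \<in> ?I" for i
  proof -
    have "distr M borel (?X i) = distr (distr M borel (Vs i)) borel (mc_sample f A)"
      using Vs_rv[OF that] by (simp add: distr_distr comp_def)
    also have "\<dots> = distr M borel ?Y"
      using Vs_distr that V_rv by (simp add: distr_distr comp_def)
    finally show ?thesis .
  qed
  have X_law: "integral\<^sup>L M (\<lambda>\<omega>. h (?X i \<omega>)) = integral\<^sup>L M (\<lambda>\<omega>. h (?Y \<omega>))"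
      "integrable M (\<lambda>\<omega>. h (?X i \<omega>)) \<longleftrightarrow> integrable M (\<lambda>\<omega>. h (?Y \<omega>))"
    if "i \<in> ?I" "h \<in> borel_measurable borel" for i and h :: "real \<Rightarrow> real"
  proof -
    have rv: "?X i \<in> borel_measurable M" using Vs_rv[OF that(1)] by simp
    show "integral\<^sup>L M (\<lambda>\<omega>. h (?X i \<omega>)) = integral\<^sup>L M (\<lambda>\<omega>. h (?Y \<omega>))"
      using integral_distr[OF rv that(2)] integral_distr[OF Y_rv that(2)] X_distr[OF that(1)] by simp
    show "integrable M (\<lambda>\<omega>. h (?X i \<omega>)) \<longleftrightarrow> integrable M (\<lambda>\<omega>. h (?Y \<omega>))"
      using integrable_distr_eq[OF rv that(2)] integrable_distr_eq[OF Y_rv that(2)]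
        X_distr[OF that(1)] by simp
  qed
  have est: "mc_estimator q f A (\<lambda>i. Vs i \<omega>) = (\<Sum>i\<in>?I. ?X i \<omega>) / real (card ?I)" for \<omega>
    by (simp add: mc_estimator_def)
  have var: "variance (\<lambda>\<omega>. mc_estimator q f A (\<lambda>i. Vs i \<omega>)) = 1 / real q * variance ?Y"
  proof -
    have Xint: "integrable M (?X i)" "integrable M (\<lambda>\<omega>. (?X i \<omega>)\<^sup>2)" if "i \<in> ?I" for i
      using X_law(2)[OF that, of "\<lambda>x. x"] X_law(2)[OF that, of power2]
        int_M[OF D.mc_sample_integrable(1)] int_M[OF D.mc_sample_integrable(2)] by auto
    have Xvar: "variance (?X i) = variance ?Y" if "i \<in> ?I" for i
      using X_law(1)[OF that, of "\<lambda>x. x"]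
        X_law(1)[OF that, of "\<lambda>x. (x - expectation ?Y)\<^sup>2"] by simp
    have "variance (\<lambda>\<omega>. \<Sum>i\<in>?I. ?X i \<omega>) = (\<Sum>i\<in>?I. variance (?X i))"
      by (intro variance_sum_indep X_indep Xint) auto
    also have "\<dots> = real q * variance ?Y" by (simp add: Xvar)
    finally have sum: "variance (\<lambda>\<omega>. \<Sum>i\<in>?I. ?X i \<omega>) = real q * variance ?Y" .
    have "variance (\<lambda>\<omega>. mc_estimator q f A (\<lambda>i. Vs i \<omega>))
        = (1 / real q)\<^sup>2 * variance (\<lambda>\<omega>. \<Sum>i\<in>?I. ?X i \<omega>)"
      by (simp add: est power_divide flip: diff_divide_distrib)
    also have "\<dots> = (1 / real q)\<^sup>2 * (real q * variance ?Y)"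
      by (simp only: sum)
    also have "\<dots> = 1 / real q * variance ?Y"
      using q_pos by (simp only: power2_eq_square) simp
    finally show ?thesis .
  qed
  have I: "finite ?I" "?I \<noteq> {}" using q_pos by auto
  have card: "real (card ?I) = real q" by simp
  show ?thesis
    using EX haar var Hoeffding_iid_mean[OF I X_indep X_distr Y_rv]
      Hoeffding_iid_mean_confidence[OF I X_indep X_distr Y_rv]
    unfolding est EX card
    by (auto simp: mc_sample_square_frame frame_proj_square[unfolded frame_proj_def])
qed

end
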